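(* Let $\phi=\frac{1+\sqrt5}{2}$ and let $R=1$. Consider all (non-degenerate) triangles $\triangle ABC$ in the Euclidean plane that circumscribe a semicircle of radius $R$ whose diameter is contained in the base $BC$, and for which the three lengths $R$, $AB$, $AC$ cannot be the three edge lengths of a triangle. Among all such triangles there is one of smallest area, and the triangle of smallest area is a right triangle similar to the triangle with side lengths $\left(1,\ \phi,\ \sqrt{1+\phi^2}\right)$.
   Context: A triangle $\triangle ABC$ circumscribes a semicircle of radius $R$ with diameter contained in the base $BC$ if the following holds: the semicircle has center $O$ on segment $BC$, its diameter (of length $2R$) lies in segment $BC$, its arc lies on the same side of line $BC$ as $A$, and the arc is tangent to the sides $AB$ and $AC$ at points $D\in AB$ and $E\in AC$. Thus $OD$ and $OE$ are radii, with $OD\perp AB$ and $OE\perp AC$. Three positive lengths $a,b,c$ cannot be the three edge lengths of a triangle if one of them is greater than or equal to the sum of the other two, that is, if they are not the side lengths of any non-degenerate triangle. *)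

theory Defs
  imports "HOL-Analysis.Analysis"
begin

type_synonym point = "real ^ 2"

definition golden :: real where
  "golden = (1 + sqrt 5) / 2"

definition nondegenerate :: "point \<Rightarrow> point \<Rightarrow> point \<Rightarrow> bool" where
  "nondegenerate A B C \<longleftrightarrow> \<not> collinear {A, B, C}"

definition triangle_area :: "point \<Rightarrow> point \<Rightarrow> point \<Rightarrow> real" where
  "triangle_area A B C = measure lborel (convex hull {A, B, C})"

text \<open>The closed half-plane bounded by the line \<open>BC\<close> that contains \<open>A\<close>
  (meaningful when \<open>A\<close>, \<open>B\<close>, \<open>C\<close> are not collinear).\<close>
definition half_plane :: "point \<Rightarrow> point \<Rightarrow> point \<Rightarrow> point set" where
  "half_plane B C A = {Q + t *\<^sub>R (A - B) | Q t. Q \<in> affine hull {B, C} \<and> 0 \<le> t}"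

text \<open>The semicircular arc, including its two endpoints on \<open>BC\<close>.\<close>
definition semicircle_arc :: "point \<Rightarrow> point \<Rightarrow> point \<Rightarrow> point \<Rightarrow> real \<Rightarrow> point set" where
  "semicircle_arc B C A M R = sphere M R \<inter> half_plane B C A"

text \<open>The line \<open>PQ\<close> is tangent at \<open>T\<close> to the circle with centre \<open>M\<close> and radius \<open>R\<close>.
  Tangency refers to the full circle, so it has its usual meaning (radius \<open>MT\<close> perpendicular
  to \<open>PQ\<close>) also when \<open>T\<close> is an endpoint of the semicircular arc.\<close>
definition tangent_at :: "point \<Rightarrow> point \<Rightarrow> point \<Rightarrow> real \<Rightarrow> point \<Rightarrow> bool" where
  "tangent_at P Q M R T \<longleftrightarrow> affine hull {P, Q} \<inter> sphere M R = {T}"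

text \<open>In the second conjunct, the part of the line \<open>BC\<close> inside the disc is the diameter.\<close>
definition circumscribes_semicircle :: "point \<Rightarrow> point \<Rightarrow> point \<Rightarrow> real \<Rightarrow> bool" where
  "circumscribes_semicircle A B C R \<longleftrightarrow> 0 < R \<and>
     (\<exists>M \<in> closed_segment B C.
        affine hull {B, C} \<inter> cball M R \<subseteq> closed_segment B C \<and>
        (\<exists>D \<in> closed_segment A B. D \<in> semicircle_arc B C A M R \<and> tangent_at A B M R D) \<and>
        (\<exists>E \<in> closed_segment A C. E \<in> semicircle_arc B C A M R \<and> tangent_at A C M R E))"

definition not_triangle_lengths :: "real \<Rightarrow> real \<Rightarrow> real \<Rightarrow> bool" where
  "not_triangle_lengths a b c \<longleftrightarrow> a \<ge> b + c \<or> b \<ge> a + c \<or> c \<ge> a + b"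

definition right_triangle :: "point \<Rightarrow> point \<Rightarrow> point \<Rightarrow> bool" where
  "right_triangle A B C \<longleftrightarrow> nondegenerate A B C \<and>
     (orthogonal (B - A) (C - A) \<or> orthogonal (A - B) (C - B) \<or> orthogonal (A - C) (B - C))"

definition similarity :: "(point \<Rightarrow> point) \<Rightarrow> bool" where
  "similarity f \<longleftrightarrow> (\<exists>k>0. \<forall>x y. dist (f x) (f y) = k * dist x y)"

text \<open>The triangle with side lengths \<open>a\<close>, \<open>b\<close>, \<open>c\<close> is determined up to congruence, so it
  does not matter which one is chosen. A similarity may match the vertices in any order.\<close>
definition similar_to_side_lengths :: "point \<Rightarrow> point \<Rightarrow> point \<Rightarrow> real \<Rightarrow> real \<Rightarrow> real \<Rightarrow> bool" where
  "similar_to_side_lengths A B C a b c \<longleftrightarrow>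
     (\<exists>P Q S f. nondegenerate P Q S \<and> dist Q S = a \<and> dist S P = b \<and> dist P Q = c \<and>
        similarity f \<and> f ` {A, B, C} = {P, Q, S})"

definition admissible :: "real \<Rightarrow> point \<Rightarrow> point \<Rightarrow> point \<Rightarrow> bool" where
  "admissible R A B C \<longleftrightarrow> nondegenerate A B C \<and> circumscribes_semicircle A B C R \<and>
     not_triangle_lengths R (dist A B) (dist A C)"

definition smallest_area :: "real \<Rightarrow> point \<Rightarrow> point \<Rightarrow> point \<Rightarrow> bool" where
  "smallest_area R A B C \<longleftrightarrow> admissible R A B C \<and>
     (\<forall>A' B' C'. admissible R A' B' C' \<longrightarrow> triangle_area A B C \<le> triangle_area A' B' C')"

end

theory Submission
  imports Defs
begin

text \<open>Write \<open>b = AC\<close>, \<open>c = AB\<close> and let \<open>K\<close> be twice the area. Splitting the triangle along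
  the segment from \<open>A\<close> to the centre of the semicircle gives two triangles of height \<open>1\<close> over
  \<open>AB\<close> and \<open>AC\<close>, so \<open>K = b + c\<close>; moreover \<open>K = b c sin A \<le> b c\<close>. Since the lengths
  \<open>1\<close>, \<open>b\<close>, \<open>c\<close> violate a triangle inequality, \<open>\<bar>b - c\<bar> \<ge> 1\<close>, and therefore
  \<open>K\<^sup>2 = (b - c)\<^sup>2 + 4 b c \<ge> 1 + 4 K\<close>, that is \<open>K \<ge> 2 + sqrt 5\<close>. Equality forces a right
  angle at \<open>A\<close> and legs \<open>golden\<close> and \<open>golden\<^sup>2\<close>, and that triangle is admissible.\<close>

section \<open>Determinants, areas and collinearity in the plane\<close>

definition cross2 :: "point \<Rightarrow> point \<Rightarrow> real" where
  "cross2 u v = u $ 1 * v $ 2 - u $ 2 * v $ 1"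

lemma cross2_commute: "cross2 u v = - cross2 v u"
  by (simp add: cross2_def)

lemma norm_sq_point: "(norm (u :: point))\<^sup>2 = (u $ 1)\<^sup>2 + (u $ 2)\<^sup>2"
  unfolding power2_norm_eq_inner inner_vec_def sum_2 by (simp add: power2_eq_square)

text \<open>This is sin^2 + cos^2 = 1 for the angle between the vectors. It bounds the area by the
  product of two sides, with equality exactly at a right angle, and also yields the distance from a
  point to a line.\<close>

lemma lagrange_identity_point: "(cross2 u v)\<^sup>2 + (u \<bullet> v)\<^sup>2 = (norm u)\<^sup>2 * (norm v)\<^sup>2"
  unfolding norm_sq_point by (simp add: cross2_def inner_vec_def sum_2 power2_eq_square algebra_simps)

lemma triangle_area_cross2: "triangle_area A B C = \<bar>cross2 (B - A) (C - A)\<bar> / 2"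
  unfolding triangle_area_def content_triangle cross2_def
  by (simp add: algebra_simps abs_minus_commute)

lemma cross2_nonzero_imp_nondegenerate:
  assumes "cross2 (B - A) (C - A) \<noteq> 0"
  shows "nondegenerate A B C"
proof -
  have "cross2 (B - A) (C - A) = 0" if "collinear {A, B, C}"
  proof -
    from that obtain u where u: "\<forall>x\<in>{A, B, C}. \<forall>y\<in>{A, B, C}. \<exists>c. x - y = c *\<^sub>R u"
      unfolding collinear_def by blast
    then obtain p q where "B - A = p *\<^sub>R u" "C - A = q *\<^sub>R u" by blast
    then show ?thesis by (simp add: cross2_def)
  qed
  with assms show ?thesis unfolding nondegenerate_def by blast
qed

section \<open>Tangency and the area of a circumscribing triangle\<close>

lemma tangent_atI:
  assumes "T \<in> affine hull {P, Q}" "dist M T = R"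
    and "\<And>X. X \<in> affine hull {P, Q} \<Longrightarrow> dist M X = R \<Longrightarrow> X = T"
  shows "tangent_at P Q M R T"
  using assms unfolding tangent_at_def sphere_def by blast

lemma tangent_at_orthogonal:
  assumes "tangent_at P Q M R T"
  shows "(T - M) \<bullet> (Q - P) = 0"
proof (cases "P = Q")
  case False
  define v where "v = Q - P"
  \<comment> \<open>With this \<open>k\<close>, the point \<open>T - k *\<^sub>R v\<close> is the
    mirror image of \<open>T\<close> in the foot of the perpendicular from \<open>M\<close>. It lies
    on the line and the circle, so tangency makes it equal to \<open>T\<close> and \<open>k\<close>
    vanishes.\<close>
  define k where "k = 2 * ((T - M) \<bullet> v) / (v \<bullet> v)"
  have v: "v \<bullet> v \<noteq> 0" using False by (simp add: v_def)
  have T: "T \<in> affine hull {P, Q}" "dist M T = R"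
    using assms unfolding tangent_at_def by auto
  have "T - k *\<^sub>R v \<in> affine hull {P, Q}"
  proof -
    from T(1) obtain b where "T = P + b *\<^sub>R (Q - P)"
      unfolding affine_hull_2_alt by blast
    then have "T - k *\<^sub>R v = P + (b - k) *\<^sub>R (Q - P)"
      by (simp add: v_def algebra_simps)
    then show ?thesis unfolding affine_hull_2_alt by blast
  qed
  moreover have "dist M (T - k *\<^sub>R v) = R"
  proof -
    have "(norm (T - k *\<^sub>R v - M))\<^sup>2 = (norm (T - M))\<^sup>2 - 2 * k * ((T - M) \<bullet> v) + k\<^sup>2 * (v \<bullet> v)"
      unfolding power2_norm_eq_inner
      by (simp add: inner_diff_left inner_diff_right inner_commute power2_eq_square algebra_simps)
    also have "\<dots> = (norm (T - M))\<^sup>2"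
      using v by (simp add: k_def power2_eq_square)
    finally show ?thesis using T(2) by (simp add: dist_norm norm_minus_commute)
  qed
  ultimately have "T - k *\<^sub>R v \<in> {T}"
    using assms unfolding tangent_at_def by (metis IntI mem_sphere)
  then show ?thesis using v by (simp add: k_def v_def)
qed simp

text \<open>The height of \<open>M\<close> over the line is \<open>R\<close>: in
  \<open>M - P\<close> the part along \<open>Q - P\<close> contributes nothing to the determinant,
  and what remains is the radius, perpendicular to \<open>Q - P\<close>.\<close>

lemma tangent_at_cross2:
  assumes "tangent_at P Q M R T"
  shows "\<bar>cross2 (Q - P) (M - P)\<bar> = norm (Q - P) * R"
proof -
  have "T \<in> affine hull {P, Q}" "dist M T = R"
    using assms unfolding tangent_at_def by auto
  then have T: "T \<in> affine hull {P, Q}" "norm (T - M) = R"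
    by (simp_all add: dist_norm norm_minus_commute)
  from T(1) obtain b where "T = P + b *\<^sub>R (Q - P)"
    unfolding affine_hull_2_alt by blast
  then have comp: "M $ i - P $ i = b * (Q $ i - P $ i) - (T $ i - M $ i)" for i
    by simp
  have "cross2 (Q - P) (M - P) = - cross2 (Q - P) (T - M)"
    unfolding cross2_def vector_minus_component comp by (simp add: algebra_simps)
  then have "(cross2 (Q - P) (M - P))\<^sup>2 = (norm (Q - P) * R)\<^sup>2"
    using lagrange_identity_point[of "T - M" "Q - P"] tangent_at_orthogonal[OF assms] T(2)
    by (simp add: cross2_commute[of "T - M"] power_mult_distrib mult.commute)
  then have "\<bar>cross2 (Q - P) (M - P)\<bar> = \<bar>norm (Q - P) * R\<bar>"
    using abs_le_square_iff by (metis order_antisym order_refl)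
  moreover have "0 \<le> R" using T(2) norm_ge_zero[of "T - M"] by simp
  ultimately show ?thesis by simp
qed

text \<open>If \<open>M\<close> divides \<open>BC\<close> in the ratio \<open>u : 1 - u\<close>, the
  triangles \<open>ABM\<close> and \<open>ACM\<close> carry these fractions of the area, and both
  have height \<open>R\<close> over their sides at \<open>A\<close>.\<close>

lemma circumscribes_semicircle_cross2:
  assumes "circumscribes_semicircle A B C R"
  shows "\<bar>cross2 (B - A) (C - A)\<bar> = R * (dist A B + dist A C)"
proof -
  from assms obtain M D E where M: "M \<in> closed_segment B C"
    and D: "tangent_at A B M R D" and E: "tangent_at A C M R E"
    unfolding circumscribes_semicircle_def by blast
  from M obtain u where u: "M = (1 - u) *\<^sub>R B + u *\<^sub>R C" "0 \<le> u" "u \<le> 1"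
    unfolding closed_segment_def by blast
  let ?K = "cross2 (B - A) (C - A)"
  have "cross2 (B - A) (M - A) = u * ?K" "cross2 (C - A) (M - A) = - ((1 - u) * ?K)"
    unfolding u(1) by (simp_all add: cross2_def algebra_simps)
  then have "u * \<bar>?K\<bar> = dist A B * R" "(1 - u) * \<bar>?K\<bar> = dist A C * R"
    using tangent_at_cross2[OF D] tangent_at_cross2[OF E] u
    by (simp_all add: abs_mult dist_norm norm_minus_commute)
  then show ?thesis by (simp add: algebra_simps)
qed

section \<open>The lower bound and its equality case\<close>

lemma golden_sq: "golden\<^sup>2 = golden + 1"
  by (simp add: golden_def power2_eq_square field_simps)

lemma golden_gt_1: "1 < golden"
  by (simp add: golden_def)

lemma admissible_area_bound:
  assumes "admissible 1 A B C"
  shows "2 * golden + 1 \<le> 2 * triangle_area A B C"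
    and "2 * triangle_area A B C \<le> 2 * golden + 1 \<Longrightarrow>
      (B - A) \<bullet> (C - A) = 0 \<and>
      (dist A B = golden \<and> dist A C = golden\<^sup>2 \<or> dist A B = golden\<^sup>2 \<and> dist A C = golden)"
proof -
  define b c K where "b = dist A C" and "c = dist A B" and "K = \<bar>cross2 (B - A) (C - A)\<bar>"
  have K: "K = b + c"
    using assms circumscribes_semicircle_cross2[of A B C 1]
    by (simp add: admissible_def K_def b_def c_def)
  have area: "2 * triangle_area A B C = K" by (simp add: triangle_area_cross2 K_def)
  have "A \<noteq> B" "A \<noteq> C"
    using assms by (auto simp: admissible_def nondegenerate_def insert_commute)
  then have pos: "b > 0" "c > 0" by (simp_all add: b_def c_def)
  have lagrange: "K\<^sup>2 + ((B - A) \<bullet> (C - A))\<^sup>2 = (b * c)\<^sup>2"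
    using lagrange_identity_point[of "B - A" "C - A"]
    by (simp add: K_def b_def c_def dist_norm norm_minus_commute power_mult_distrib mult.commute)
  then have "K\<^sup>2 \<le> (b * c)\<^sup>2" by (smt (verit) zero_le_power2)
  then have K_le: "K \<le> b * c" using pos by (auto intro!: power2_le_imp_le[of K "b * c"])
  \<comment> \<open>The only failing inequality that does not force a difference of at least 1 is
    excluded: \<open>b + c \<le> 1\<close> gives \<open>c < 1\<close>, hence
    \<open>b * c < b < K\<close>.\<close>
  have "\<not> b + c \<le> 1"
  proof
    assume le: "b + c \<le> 1"
    have "b * c < b * 1" by (rule mult_strict_left_mono) (use pos le in auto)
    then show False using K_le K pos by linarith
  qed
  then have "1 \<le> \<bar>b - c\<bar>"
    using assms by (auto simp: admissible_def not_triangle_lengths_def b_def c_def)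
  then have diff: "1 \<le> (b - c)\<^sup>2" using one_le_power[of "\<bar>b - c\<bar>" 2] by simp
  have K_sq: "K\<^sup>2 = (b - c)\<^sup>2 + 4 * (b * c)" by (simp add: K power2_eq_square algebra_simps)
  \<comment> \<open>The roots of x^2 - 4x - 1 are 2 + sqrt 5 and 2 - sqrt 5, which are
    \<open>2 * golden + 1\<close> and \<open>3 - 2 * golden\<close>.\<close>
  have factor: "(K - (2 * golden + 1)) * (K + (2 * golden - 3)) = K\<^sup>2 - 4 * K - 1"
    using golden_sq by algebra
  have "K + (2 * golden - 3) > 0"
  proof -
    have "K * 4 \<le> K * K" using K_sq diff K_le unfolding power2_eq_square by linarith
    moreover have "0 < K" using K pos by linarith
    ultimately have "4 \<le> K" using mult_le_cancel_left_pos by blast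
    then show ?thesis using golden_gt_1 by linarith
  qed
  moreover have "0 \<le> K\<^sup>2 - 4 * K - 1" using K_sq diff K_le by linarith
  ultimately have K_ge: "2 * golden + 1 \<le> K"
    using factor mult_neg_pos[of "K - (2 * golden + 1)" "K + (2 * golden - 3)"] by linarith
  then show "2 * golden + 1 \<le> 2 * triangle_area A B C" using area by simp
  show "(B - A) \<bullet> (C - A) = 0 \<and>
      (dist A B = golden \<and> dist A C = golden\<^sup>2 \<or> dist A B = golden\<^sup>2 \<and> dist A C = golden)"
    if "2 * triangle_area A B C \<le> 2 * golden + 1"
  proof -
    have Keq: "K = 2 * golden + 1" using that area K_ge by simp
    then have "K\<^sup>2 - 4 * K - 1 = 0" using factor by simp
    \<comment> \<open>\<open>K\<^sup>2 - 4 * K - 1\<close> is the sum of the nonnegative terms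
      \<open>(b - c)\<^sup>2 - 1\<close> and \<open>4 * (b * c - K)\<close>, so both vanish.\<close>
    then have "(b - c)\<^sup>2 = 1" "K = b * c" using K_sq diff K_le by linarith+
    then have "b - c = 1 \<or> b - c = - 1" "((B - A) \<bullet> (C - A))\<^sup>2 = 0"
      using lagrange by (simp_all add: power2_eq_1_iff)
    then show ?thesis using Keq K golden_sq unfolding b_def c_def by auto
  qed
qed

section \<open>The extremal triangle in coordinates\<close>

definition opt_B :: point where "opt_B = vector [golden, 0]"
definition opt_C :: point where "opt_C = vector [0, golden\<^sup>2]"

lemma admissible_opt: "admissible 1 0 opt_B opt_C"
proof -
  let ?g = golden
  \<comment> \<open>The legs lie on the axes, so the unit circle touching both from inside the
    quadrant has centre (1, 1).\<close>
  define M D E :: point where "M = vector [1, 1]" and "D = vector [1, 0]" and "E = vector [0, 1]"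
  note vec_simps = vec_eq_iff forall_2 M_def D_def E_def opt_B_def opt_C_def
  have g: "?g > 1" "?g\<^sup>2 = ?g + 1" by (rule golden_gt_1, rule golden_sq)
  have g0: "?g > 0" using g by simp
  \<comment> \<open>This says that (1, 1) satisfies the equation x/golden + y/golden^2 = 1 of the
    hypotenuse.\<close>
  have split: "1 / ?g + 1 / ?g\<^sup>2 = 1"
    using g0 golden_sq by (simp add: field_simps) algebra
  have inv: "0 \<le> 1 / ?g" "1 / ?g \<le> 1" "0 \<le> 1 / ?g\<^sup>2" "1 / ?g\<^sup>2 \<le> 1"
    using g by (simp_all add: field_simps)
  have M: "M \<in> closed_segment opt_B opt_C"
  proof -
    have "M = (1 - 1 / ?g\<^sup>2) *\<^sub>R opt_B + (1 / ?g\<^sup>2) *\<^sub>R opt_C"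
      using split g0 by (simp add: vec_simps) (simp add: field_simps)
    then show ?thesis unfolding closed_segment_def using inv by blast
  qed
  have diam: "affine hull {opt_B, opt_C} \<inter> cball M 1 \<subseteq> closed_segment opt_B opt_C"
  proof
    fix X assume X: "X \<in> affine hull {opt_B, opt_C} \<inter> cball M 1"
    then obtain a b where ab: "X = a *\<^sub>R opt_B + b *\<^sub>R opt_C" "a + b = 1"
      unfolding affine_hull_2 by blast
    have "norm (X - M) \<le> 1" using X by (simp add: dist_norm norm_minus_commute)
    \<comment> \<open>The disc lies in the square [0, 2] x [0, 2], and a point of the hypotenuse
      line with nonnegative coordinates is on the hypotenuse.\<close>
    then have "\<bar>(X - M) $ i\<bar> \<le> 1" for i using component_le_norm_cart order_trans by blast
    from this[of 1] this[of 2] have "0 \<le> a * ?g" "0 \<le> b * ?g\<^sup>2"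
      by (simp_all add: ab(1) vec_simps)
    then have "0 \<le> a" "0 \<le> b" using g0 by (simp_all add: zero_le_mult_iff)
    then have "a = 1 - b" "0 \<le> b" "b \<le> 1" using ab(2) by auto
    then show "X \<in> closed_segment opt_B opt_C" unfolding closed_segment_def using ab(1) by blast
  qed
  have segD: "D \<in> closed_segment 0 opt_B"
  proof -
    have "D = (1 - 1 / ?g) *\<^sub>R 0 + (1 / ?g) *\<^sub>R opt_B"
      using g0 by (simp add: vec_simps)
    then show ?thesis unfolding closed_segment_def using inv by blast
  qed
  have segE: "E \<in> closed_segment 0 opt_C"
  proof -
    have "E = (1 - 1 / ?g\<^sup>2) *\<^sub>R 0 + (1 / ?g\<^sup>2) *\<^sub>R opt_C"
      using g0 by (simp add: vec_simps)
    then show ?thesis unfolding closed_segment_def using inv by blast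
  qed
  have hpD: "D \<in> half_plane opt_B opt_C 0"
  proof -
    have "D = opt_B + (1 - 1 / ?g) *\<^sub>R (0 - opt_B)"
      using g0 by (simp add: vec_simps field_simps)
    moreover have "opt_B \<in> affine hull {opt_B, opt_C}" by (simp add: hull_inc)
    ultimately show ?thesis unfolding half_plane_def using inv by fastforce
  qed
  have hpE: "E \<in> half_plane opt_B opt_C 0"
  proof -
    \<comment> \<open>The point of the hypotenuse at height 1; moving parallel to the leg
      \<open>opt_B\<close> leads from it to \<open>E\<close>.\<close>
    let ?Q = "(1 - 1 / ?g\<^sup>2) *\<^sub>R opt_B + (1 / ?g\<^sup>2) *\<^sub>R opt_C"
    have "E = ?Q + (1 - 1 / ?g\<^sup>2) *\<^sub>R (0 - opt_B)"
      using g0 by (simp add: vec_simps)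
    moreover have "?Q \<in> affine hull {opt_B, opt_C}"
      unfolding affine_hull_2 by (rule CollectI) (intro exI conjI, rule refl, simp)
    ultimately show ?thesis unfolding half_plane_def using inv by fastforce
  qed
  have dist1: "dist M X = 1 \<longleftrightarrow> (X $ 1 - 1)\<^sup>2 + (X $ 2 - 1)\<^sup>2 = 1" for X
  proof -
    have "dist M X = 1 \<longleftrightarrow> (norm (X - M))\<^sup>2 = 1"
      by (simp add: dist_norm norm_minus_commute power2_eq_1_iff) (smt (verit) norm_ge_zero)
    then show ?thesis unfolding norm_sq_point by (simp add: M_def)
  qed
  have tanD: "tangent_at 0 opt_B M 1 D"
  proof -
    have "D \<in> affine hull {0, opt_B}" using segD
      by (metis convex_hull_subset_affine_hull segment_convex_hull subsetD)
    moreover have "X = D" if "X \<in> affine hull {0, opt_B}" "dist M X = 1" for X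
      using that unfolding affine_hull_2_alt dist1 by (auto simp: vec_simps)
    moreover have "dist M D = 1" by (simp add: dist1 D_def)
    ultimately show ?thesis by (intro tangent_atI)
  qed
  have tanE: "tangent_at 0 opt_C M 1 E"
  proof -
    have "E \<in> affine hull {0, opt_C}" using segE
      by (metis convex_hull_subset_affine_hull segment_convex_hull subsetD)
    moreover have "X = E" if "X \<in> affine hull {0, opt_C}" "dist M X = 1" for X
      using that unfolding affine_hull_2_alt dist1 by (auto simp: vec_simps)
    moreover have "dist M E = 1" by (simp add: dist1 E_def)
    ultimately show ?thesis by (intro tangent_atI)
  qed
  have "dist M D = 1" "dist M E = 1" by (simp_all add: dist1 D_def E_def)
  then have "circumscribes_semicircle 0 opt_B opt_C 1"
    unfolding circumscribes_semicircle_def semicircle_arc_def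
    using M diam segD segE hpD hpE tanD tanE by auto
  moreover have "nondegenerate 0 opt_B opt_C"
    by (rule cross2_nonzero_imp_nondegenerate) (use g0 in \<open>simp add: cross2_def opt_B_def opt_C_def\<close>)
  moreover have "not_triangle_lengths 1 (dist 0 opt_B) (dist 0 opt_C)"
  proof -
    have "(norm opt_B)\<^sup>2 = ?g\<^sup>2" "(norm opt_C)\<^sup>2 = (?g\<^sup>2)\<^sup>2"
      unfolding norm_sq_point by (simp_all add: opt_B_def opt_C_def)
    then have "norm opt_B = ?g" "norm opt_C = ?g\<^sup>2"
      using g0 by (auto intro: power2_eq_imp_eq)
    \<comment> \<open>The triangle inequality fails with equality: the longer leg is
      \<open>golden\<^sup>2 = golden + 1\<close>.\<close>
    then show ?thesis using g(2) by (simp add: not_triangle_lengths_def)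
  qed
  ultimately show ?thesis unfolding admissible_def by blast
qed

lemma triangle_area_opt: "2 * triangle_area 0 opt_B opt_C = 2 * golden + 1"
proof -
  have "2 * triangle_area 0 opt_B opt_C = golden * golden\<^sup>2"
    using golden_gt_1 by (simp add: triangle_area_cross2 cross2_def opt_B_def opt_C_def)
  also have "\<dots> = 2 * golden + 1" using golden_sq by algebra
  finally show ?thesis .
qed

lemma smallest_area_opt: "smallest_area 1 0 opt_B opt_C"
proof -
  have "triangle_area 0 opt_B opt_C \<le> triangle_area A B C" if "admissible 1 A B C" for A B C
    using admissible_area_bound(1)[OF that] triangle_area_opt by linarith
  then show ?thesis unfolding smallest_area_def using admissible_opt by blast
qed

section \<open>The shape of the minimal triangles\<close>

lemma similar_to_golden:
  assumes orth: "(B - A) \<bullet> (C - A) = 0"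
    and c: "dist A B = golden" and b: "dist A C = golden\<^sup>2"
  shows "similar_to_side_lengths A B C 1 golden (sqrt (1 + golden\<^sup>2))"
proof -
  \<comment> \<open>Scaling by \<open>1 / golden\<close> turns the legs \<open>golden\<close> and
    \<open>golden\<^sup>2\<close> into 1 and \<open>golden\<close>.\<close>
  let ?k = "1 / golden"
  let ?f = "\<lambda>X :: point. ?k *\<^sub>R X"
  have g0: "golden > 0" using golden_gt_1 by simp
  have dist_f: "dist (?f X) (?f Y) = ?k * dist X Y" for X Y
    using g0 by (simp add: dist_norm flip: scaleR_diff_right)
  have "(cross2 (B - A) (C - A))\<^sup>2 = (golden * golden\<^sup>2)\<^sup>2"
    using lagrange_identity_point[of "B - A" "C - A"] orth b c
    by (simp add: dist_norm norm_minus_commute power_mult_distrib)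
  moreover have "cross2 (?f B - ?f A) (?f C - ?f A) = ?k\<^sup>2 * cross2 (B - A) (C - A)"
    by (simp add: cross2_def power2_eq_square algebra_simps)
  ultimately have "cross2 (?f B - ?f A) (?f C - ?f A) \<noteq> 0" using g0 by auto
  \<comment> \<open>The order \<open>C\<close>, \<open>B\<close>, \<open>A\<close> makes the side
    lengths appear as 1, \<open>golden\<close>, hypotenuse in
    \<open>similar_to_side_lengths\<close>.\<close>
  then have nd: "nondegenerate (?f C) (?f B) (?f A)"
    using cross2_nonzero_imp_nondegenerate[of "?f B" "?f A" "?f C"]
    by (metis insert_commute nondegenerate_def)
  have "(dist C B)\<^sup>2 = (dist A B)\<^sup>2 + (dist A C)\<^sup>2"
  proof -
    have "C - B = (C - A) - (B - A)" by simp
    then have "(norm (C - B))\<^sup>2 = (norm (C - A))\<^sup>2 + (norm (B - A))\<^sup>2"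
      using orth by (simp only: power2_norm_eq_inner) (simp add: inner_diff_left inner_diff_right inner_commute)
    then show ?thesis by (simp add: dist_norm norm_minus_commute)
  qed
  then have "(dist C B)\<^sup>2 = golden\<^sup>2 * (1 + golden\<^sup>2)"
    unfolding b c by (simp add: algebra_simps power2_eq_square)
  then have "dist C B = golden * sqrt (1 + golden\<^sup>2)"
    using g0 by (metis abs_of_pos real_sqrt_abs real_sqrt_mult real_sqrt_unique zero_le_dist)
  then have "dist (?f C) (?f B) = sqrt (1 + golden\<^sup>2)" using g0 by (simp add: dist_f)
  moreover have "dist (?f B) (?f A) = 1" "dist (?f A) (?f C) = golden"
    using g0 by (simp_all add: dist_f b c dist_commute power2_eq_square)
  moreover have "similarity ?f"
    unfolding similarity_def using g0 dist_f by (intro exI[of _ ?k]) simp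
  moreover have "?f ` {A, B, C} = {?f C, ?f B, ?f A}" by auto
  ultimately show ?thesis unfolding similar_to_side_lengths_def using nd by blast
qed

theorem proposition1p2:
  fixes R :: real
  assumes "R = 1"
  shows "(\<exists>A B C. smallest_area R A B C) \<and>
    (\<forall>A B C. smallest_area R A B C \<longrightarrow>
       right_triangle A B C \<and>
       similar_to_side_lengths A B C 1 golden (sqrt (1 + golden\<^sup>2)))"
proof (intro conjI allI impI)
  show "\<exists>A B C. smallest_area R A B C" using smallest_area_opt assms by blast
next
  fix A B C
  assume min: "smallest_area R A B C"
  then have adm: "admissible 1 A B C" and nondeg: "nondegenerate A B C"
    using assms by (simp_all add: smallest_area_def admissible_def)
  have "triangle_area A B C \<le> triangle_area 0 opt_B opt_C"
    using min admissible_opt assms by (simp add: smallest_area_def)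
  then have "2 * triangle_area A B C \<le> 2 * golden + 1" using triangle_area_opt by simp
  note eq = admissible_area_bound(2)[OF adm this]
  show "right_triangle A B C"
    using nondeg eq by (simp add: right_triangle_def orthogonal_def)
  have "similar_to_side_lengths A B C 1 golden (sqrt (1 + golden\<^sup>2)) \<or>
      similar_to_side_lengths A C B 1 golden (sqrt (1 + golden\<^sup>2))"
    using similar_to_golden[of B A C] similar_to_golden[of C A B] eq inner_commute[of "B - A" "C - A"]
    by auto
  \<comment> \<open>Which leg is the longer one does not matter, since similarity sees only the set
    of vertices.\<close>
  then show "similar_to_side_lengths A B C 1 golden (sqrt (1 + golden\<^sup>2))"
    by (simp add: similar_to_side_lengths_def insert_commute)
qed

end
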